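(* For every integer $n \ge 0$ with $n \neq 1$, $$g_n = -L(F_n(s)).$$
   Context: The numbers $g_n$ ($n\ge 0$) are defined by the exponential generating function $\frac{2z}{1+e^z} = \sum_{n\ge 0} g_n \frac{z^n}{n!}$. The Fibonacci polynomials $F_n(s)$ are defined by $F_0(s)=0$, $F_1(s)=1$ and $F_n(s)=F_{n-1}(s)+sF_{n-2}(s)$ for $n\ge 2$; explicitly $F_n(s)=\sum_{k=0}^{n-1}\binom{n-k-1}{k}s^k$ for $n \ge 1$. Since $F_{2k+1}(s)$ has degree $k$, the polynomials $F_{2k+1}(s)$, $k\ge 0$, form a basis of $\mathbb{C}[s]$, and $L$ denotes the linear functional on $\mathbb{C}[s]$ determined by $L(F_1(s))=1$ and $L(F_{2k+1}(s))=0$ for all $k\ge 1$. *)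

theory Defs
  imports Complex_Main "HOL-Computational_Algebra.Polynomial"
    "HOL-Computational_Algebra.Formal_Power_Series"
begin

(* The exponential generating function is taken as a formal power series; 1 + exp z has constant
   term 2, hence is a unit, and the quotient is exact. *)
definition genocchi :: "nat \<Rightarrow> complex" where
  "genocchi n = fact n * fps_nth (2 * fps_X / (1 + fps_exp 1)) n"

fun fib_poly :: "nat \<Rightarrow> complex poly" where
  "fib_poly 0 = 0"
| "fib_poly (Suc 0) = 1"
| "fib_poly (Suc (Suc n)) = fib_poly (Suc n) + [:0, 1:] * fib_poly n"

definition is_fib_functional :: "(complex poly \<Rightarrow> complex) \<Rightarrow> bool" where
  "is_fib_functional L \<longleftrightarrow>
     Vector_Spaces.linear smult (*) L \<and>
     L (fib_poly 1) = 1 \<and>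
     (\<forall>k\<ge>1. L (fib_poly (2 * k + 1)) = 0)"

definition fib_functional :: "complex poly \<Rightarrow> complex" where
  "fib_functional = (THE L. is_fib_functional L)"

(* The odd-indexed Fibonacci polynomials form a basis of C[s], so fib_functional is well defined. *)

lemma fib_poly_odd_degree:
  "degree (fib_poly (2 * k + 1)) = k \<and> coeff (fib_poly (2 * k + 1)) k = 1
   \<and> degree (fib_poly (2 * k + 2)) \<le> k"
proof (induction k)
  case 0
  show ?case by (simp add: numeral_2_eq_2)
next
  case (Suc k)
  let ?A = "fib_poly (2 * k + 1)" and ?B = "fib_poly (2 * k + 2)"
  let ?C = "fib_poly (2 * Suc k + 1)" and ?D = "fib_poly (2 * Suc k + 2)"
  have C: "?C = ?B + pCons 0 ?A" and D: "?D = ?C + pCons 0 ?B"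
    by simp_all
  from Suc have A: "degree ?A = k" "coeff ?A k = 1" and B: "degree ?B \<le> k"
    by auto
  have "coeff ?B (Suc k) = 0"
    using B by (intro coeff_eq_0) linarith
  then have c: "coeff ?C (Suc k) = 1"
    unfolding C using A by simp
  have le: "degree ?C \<le> Suc k"
    unfolding C using A B by (intro degree_add_le degree_pCons_le[THEN order_trans]) auto
  have "Suc k \<le> degree ?C"
    using c by (intro le_degree) simp
  moreover have "degree ?D \<le> Suc k"
    unfolding D using le B by (intro degree_add_le degree_pCons_le[THEN order_trans]) auto
  ultimately show ?case
    using le c by simp
qed

lemma ex1_is_fib_functional: "\<exists>!L. is_fib_functional L"
proof -
  interpret P: vector_space "smult :: complex \<Rightarrow> complex poly \<Rightarrow> complex poly"
    by unfold_locales (simp_all add: smult_add_right smult_add_left)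
  interpret PC: vector_space_pair "smult :: complex \<Rightarrow> complex poly \<Rightarrow> complex poly"
    "(*) :: complex \<Rightarrow> complex \<Rightarrow> complex"
    by unfold_locales (simp_all add: algebra_simps)
  define b where "b k = fib_poly (2 * k + 1)" for k
  have deg: "degree (b k) = k" and lc: "coeff (b k) k = 1" for k
    using fib_poly_odd_degree[of k] by (auto simp: b_def)
  have inj: "inj b"
    by (metis deg injI)
  have indep: "P.independent (b ` {..<n})" for n
  proof (induction n)
    case 0
    show ?case by (simp add: P.independent_empty)
  next
    case (Suc n)
    have "coeff p n = 0" if "p \<in> P.span (b ` {..<n})" for p
      using that
    proof (induction rule: P.span_induct_alt)
      case base
      show ?case by simp
    next
      case (step c x y)
      then show ?case using deg by (auto simp: coeff_eq_0)
    qed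
    then have "b n \<notin> P.span (b ` {..<n})"
      using lc[of n] by force
    then show ?case
      using Suc by (simp add: lessThan_Suc P.independent_insertI)
  qed
  have ind: "P.independent (range b)"
  proof (rule ccontr)
    assume "\<not> P.independent (range b)"
    then obtain T u where T: "finite T" "T \<subseteq> range b" "(\<Sum>v\<in>T. smult (u v) v) = 0" "\<exists>v\<in>T. u v \<noteq> 0"
      unfolding P.dependent_explicit by blast
    then obtain I where I: "finite I" "T = b ` I"
      by (meson finite_subset_image)
    then obtain n where "I \<subseteq> {..<n}"
      by (meson finite_nat_iff_bounded)
    then have "T \<subseteq> b ` {..<n}" using I by blast
    with T indep[of n] show False
      unfolding P.dependent_explicit by blast
  qed
  have span: "p \<in> P.span (range b)" for p
  proof (induction "degree p" arbitrary: p rule: less_induct)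
    case less
    define q where "q = p - smult (lead_coeff p) (b (degree p))"
    have "degree q \<le> degree p" "coeff q (degree p) = 0"
      unfolding q_def using deg lc
      by (auto intro!: degree_diff_le order_trans[OF degree_smult_le])
    then have "q = 0 \<or> degree q < degree p"
      by (metis le_neq_implies_less leading_coeff_0_iff)
    then have "q \<in> P.span (range b)"
      using less P.span_zero by blast
    moreover have "smult (lead_coeff p) (b (degree p)) \<in> P.span (range b)"
      by (intro P.span_scale P.span_base) auto
    ultimately have "q + smult (lead_coeff p) (b (degree p)) \<in> P.span (range b)"
      by (rule P.span_add)
    then show ?case by (simp add: q_def)
  qed
  obtain L where L: "Vector_Spaces.linear smult (*) L"
      and Lb: "\<And>x. x \<in> range b \<Longrightarrow> L x = (if x = b 0 then 1 else 0)"
    using PC.linear_independent_extend[OF ind, of "\<lambda>x. if x = b 0 then 1 else 0"] by blast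
  have "is_fib_functional L"
    unfolding is_fib_functional_def
  proof (intro conjI allI impI)
    show "L (fib_poly 1) = 1"
      using Lb[OF rangeI[of b 0]] by (simp add: b_def)
    show "L (fib_poly (2 * k + 1)) = 0" if "1 \<le> k" for k
    proof -
      have "b k \<noteq> b 0" using that inj by (auto dest: injD)
      then show ?thesis using Lb[OF rangeI[of b k]] by (simp add: b_def)
    qed
  qed (fact L)
  moreover have "M = N" if M: "is_fib_functional M" and N: "is_fib_functional N" for M N
  proof
    fix p
    have "M (b k) = N (b k)" for k
      using M N by (cases "k = 0") (auto simp: is_fib_functional_def b_def)
    then show "M p = N p"
      using M N span[of p]
      by (intro PC.linear_eq_on[of M N p "range b"]) (auto simp: is_fib_functional_def)
  qed
  ultimately show ?thesis by blast
qed

lemma is_fib_functional_fib_functional: "is_fib_functional fib_functional"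
  unfolding fib_functional_def by (rule theI'[OF ex1_is_fib_functional])

end

theory Submission
  imports Defs
begin

text \<open>
  Write \<open>F\<^sub>n = (\<alpha>\<^sup>n - \<beta>\<^sup>n) / (\<alpha> - \<beta>)\<close> with \<open>\<alpha> + \<beta> = 1\<close> and \<open>\<alpha>\<beta> = -s\<close>.
  The binomial transform replaces \<open>\<alpha>\<^sup>n\<close> by \<open>(1 - \<alpha>)\<^sup>n = \<beta>\<^sup>n\<close> and vice versa, so it maps
  the sequence \<open>F\<^sub>n\<close> to its negative. This passes to \<open>L(F\<^sub>n)\<close>, whose
  exponential generating function \<open>H\<close> therefore satisfies \<open>H(-z) e\<^sup>z = -H(z)\<close>. Since
  \<open>L\<close> kills the odd-indexed \<open>F\<^sub>n\<close> except \<open>F\<^sub>1\<close>, also \<open>H(z) - H(-z) = 2z\<close>. Eliminating \<open>H(-z)\<close>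
  gives \<open>H(z) = 2z - 2z / (1 + e\<^sup>z)\<close>.
\<close>

definition binomial_transform :: "(nat \<Rightarrow> 'a::comm_ring_1) \<Rightarrow> nat \<Rightarrow> 'a" where
  "binomial_transform f n = (\<Sum>k\<le>n. of_nat (n choose k) * (-1) ^ k * f k)"

lemma binomial_transform_add:
  "binomial_transform (\<lambda>k. f k + g k) n = binomial_transform f n + binomial_transform g n"
  by (simp add: binomial_transform_def algebra_simps sum.distrib)

lemma binomial_transform_mult_left:
  "binomial_transform (\<lambda>k. c * f k) n = c * binomial_transform f n"
  by (simp add: binomial_transform_def sum_distrib_left mult_ac)

text \<open>Pascal's rule. With \<open>S\<close> the shift of sequences, raising the index by one
  amounts to applying \<open>1 - S\<close> to \<open>f\<close>.\<close>

lemma binomial_transform_Suc: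
  "binomial_transform f (Suc n) = binomial_transform f n - binomial_transform (\<lambda>k. f (Suc k)) n"
proof -
  have "binomial_transform f (Suc n) =
      f 0 + (\<Sum>k\<le>n. of_nat (Suc n choose Suc k) * (-1) ^ Suc k * f (Suc k))"
    unfolding binomial_transform_def by (subst sum.atMost_Suc_shift) simp
  also have "\<dots> = f 0 + (\<Sum>k\<le>n. of_nat (n choose Suc k) * (-1) ^ Suc k * f (Suc k))
      - binomial_transform (\<lambda>k. f (Suc k)) n"
    by (simp add: binomial_transform_def algebra_simps sum.distrib sum_negf sum_subtractf)
  also have "f 0 + (\<Sum>k\<le>n. of_nat (n choose Suc k) * (-1) ^ Suc k * f (Suc k)) =
      (\<Sum>k\<le>Suc n. of_nat (n choose k) * (-1) ^ k * f k)"
    by (subst sum.atMost_Suc_shift) simp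
  also have "\<dots> = binomial_transform f n"
    by (simp add: binomial_transform_def binomial_eq_0)
  finally show ?thesis .
qed

text \<open>The relation \<open>S^2 = S + s\<close> is invariant under replacing \<open>S\<close> by
  \<open>1 - S\<close>, so the transform obeys the Fibonacci recurrence too; its initial values 0
  and -1 give the sign.\<close>

lemma binomial_transform_fib_poly: "binomial_transform fib_poly n = - fib_poly n"
proof (induction n rule: fib_poly.induct)
  case 1
  show ?case by (simp add: binomial_transform_def)
next
  case 2
  show ?case by (simp add: binomial_transform_def)
next
  case (3 n)
  let ?T = "\<lambda>j. binomial_transform (\<lambda>k. fib_poly (k + j)) n"
  have "?T 2 = ?T 1 + [:0, 1:] * ?T 0"
    by (simp add: binomial_transform_add binomial_transform_mult_left del: mult_pCons_left)
  moreover have "binomial_transform fib_poly (Suc n) = ?T 0 - ?T 1"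
    by (simp add: binomial_transform_Suc)
  moreover have "binomial_transform fib_poly (Suc (Suc n)) = ?T 0 - 2 * ?T 1 + ?T 2"
    by (simp add: binomial_transform_Suc del: fib_poly.simps)
  ultimately have "binomial_transform fib_poly (Suc (Suc n)) =
      binomial_transform fib_poly (Suc n) + [:0, 1:] * binomial_transform fib_poly n"
    by (simp del: mult_pCons_left)
  with 3 show ?case by simp
qed

lemma binomial_transform_linear:
  assumes "Vector_Spaces.linear smult (*) L"
  shows "L (binomial_transform f n) = binomial_transform (\<lambda>k. L (f k)) n"
proof -
  interpret L: Vector_Spaces.linear smult "(*)" L by (fact assms)
  \<comment> \<open>Constant polynomial factors become scalars, which commute with
    \<open>L\<close>.\<close>
  have "of_nat a * (-1) ^ k * p = smult (of_nat a * (-1) ^ k) p" for a k and p :: "'a poly"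
    by (induction k) (simp_all add: of_nat_poly)
  then show ?thesis
    by (simp add: binomial_transform_def L.sum L.scale)
qed

text \<open>The Cauchy product supplies \<open>1 / (k! (n - k)!)\<close>, the binomial coefficient
  over \<open>n!\<close>.\<close>

lemma egf_times_exp:
  fixes f :: "nat \<Rightarrow> 'a::field_char_0"
  shows "Abs_fps (\<lambda>n. (-1) ^ n * f n / fact n) * fps_exp 1 =
    Abs_fps (\<lambda>n. binomial_transform f n / fact n)"
proof (rule fps_ext)
  fix n
  have "(\<Sum>k\<le>n. (-1) ^ k * f k / fact k * (1 / fact (n - k))) =
      (\<Sum>k\<le>n. of_nat (n choose k) * (-1) ^ k * f k / fact n)"
    by (intro sum.cong refl) (simp add: binomial_fact field_simps)
  then show "fps_nth (Abs_fps (\<lambda>n. (-1) ^ n * f n / fact n) * fps_exp 1) n =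
      fps_nth (Abs_fps (\<lambda>n. binomial_transform f n / fact n)) n"
    by (simp add: fps_mult_nth binomial_transform_def sum_divide_distrib atLeast0AtMost)
qed

theorem corollary1p2:
  fixes n :: nat
  assumes "n \<noteq> 1"
  shows "genocchi n = - fib_functional (fib_poly n)"
proof -
  define l where "l k = fib_functional (fib_poly k)" for k
  define H H' G E where "H = Abs_fps (\<lambda>k. l k / fact k)"
    and "H' = Abs_fps (\<lambda>k. (-1) ^ k * l k / fact k)"
    and "G = 2 * fps_X / (1 + fps_exp (1::complex))" and "E = fps_exp (1::complex)"
  have L: "Vector_Spaces.linear smult (*) fib_functional" and l1: "l 1 = 1"
    and l_odd: "\<And>k. k \<ge> 1 \<Longrightarrow> l (2 * k + 1) = 0"
    using is_fib_functional_fib_functional by (auto simp: is_fib_functional_def l_def)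
  interpret L: Vector_Spaces.linear smult "(*)" fib_functional by (fact L)
  have "binomial_transform l k = - l k" for k
    using binomial_transform_linear[OF L, of fib_poly k]
    by (simp add: binomial_transform_fib_poly L.neg l_def[abs_def])
  then have reflect: "H' * E = - H"
    by (simp add: H'_def H_def E_def egf_times_exp fps_eq_iff)
  have odd: "H - H' = 2 * fps_X"
  proof (rule fps_ext)
    fix k
    show "fps_nth (H - H') k = fps_nth (2 * fps_X) k"
    \<comment> \<open>Even coefficients cancel and odd ones double, leaving only
      \<open>2 * l 1 = 2\<close>.\<close>
    proof (cases "even k")
      case True
      then show ?thesis by (auto simp: H_def H'_def numeral_fps_const)
    next
      case False
      then obtain j where "k = 2 * j + 1" by (elim oddE)
      then show ?thesis
        using l1 l_odd[of j] by (cases "j = 0") (auto simp: H_def H'_def numeral_fps_const)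
    qed
  qed
  have unit: "fps_nth (1 + E) 0 \<noteq> 0"
    by (simp add: E_def)
  then have nz: "1 + E \<noteq> 0"
    by (metis fps_zero_nth)
  have "(1 + E) dvd 2 * fps_X"
    using unit by (meson fps_is_unit_iff unit_imp_dvd)
  then have "G * (1 + E) = 2 * fps_X"
    by (simp add: G_def E_def)
  \<comment> \<open>Multiply \<open>odd\<close> by \<open>E\<close> and replace
    \<open>H' * E\<close> by \<open>- H\<close>.\<close>
  moreover have "H * (1 + E) = 2 * fps_X * E"
    using reflect odd by algebra
  ultimately have "(G + H) * (1 + E) = 2 * fps_X * (1 + E)"
    by (simp add: algebra_simps)
  then have "G + H = 2 * fps_X"
    using nz mult_right_cancel by blast
  \<comment> \<open>The series \<open>2 * fps_X\<close> has its only nonzero coefficient at index 1,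
    which is excluded.\<close>
  then have "fps_nth G n + l n / fact n = 0"
    using assms by (simp add: fps_eq_iff H_def numeral_fps_const)
  then show ?thesis
    unfolding genocchi_def G_def[symmetric] by (simp add: l_def field_simps eq_neg_iff_add_eq_0)
qed

end
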